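(* Let $\mathbb{K}$ be a field, $N\geq 1$, and let $(\mathfrak{g}_{(1,0,\ldots,0)},\triangleleft)$ be the (non unitary) associative algebra $\mathbb{K}^N$ with $\epsilon_i\triangleleft\epsilon_j=\delta_{1,j}\epsilon_i$ for $1\le i,j\le N$. 1. Let $V$ be a module over the associative (non unitary) algebra $(\mathfrak{g}_{(1,0,\ldots,0)},\triangleleft)$. Then $V=V^{(0)}\oplus V^{(1)}$, with: - $\epsilon_1.v=v$ if $v\in V^{(1)}$ and $\epsilon_1.v=0$ if $v\in V^{(0)}$; - for all $i\geq 2$, $\epsilon_i.v\in V^{(0)}$ if $v\in V^{(1)}$ and $\epsilon_i.v=0$ if $v\in V^{(0)}$. 2. Conversely, let $V=V^{(1)}\oplus V^{(0)}$ be a vector space and let $f_i:V^{(1)}\longrightarrow V^{(0)}$ be a linear map for all $2\leq i\leq N$. One defines a structure of $(\mathfrak{g}_{(1,0,\ldots,0)},\triangleleft)$-module over $V$ by $$\epsilon_1.v=\begin{cases}v&\text{if }v\in V^{(1)},\\0&\text{if }v\in V^{(0)};\end{cases}\qquad\text{and, for } i\geq 2,\quad \epsilon_i.v=\begin{cases}f_i(v)&\text{if }v\in V^{(1)},\\0&\text{if }v\in V^{(0)}.\end{cases}$$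
   Context: $(\epsilon_1,\ldots,\epsilon_N)$ is the canonical basis of $\mathbb{K}^N$. Modules are left modules over a not necessarily unital algebra: $x.(y.v)=(x\triangleleft y).v$. $V^{(0)}$, $V^{(1)}$ denote subspaces of $V$. *)

theory Defs
  imports "HOL-Analysis.Analysis"
begin

definition bilinear_map ::
  "('k::field \<Rightarrow> 'a::ab_group_add \<Rightarrow> 'a) \<Rightarrow> ('k \<Rightarrow> 'b::ab_group_add \<Rightarrow> 'b) \<Rightarrow>
   ('k \<Rightarrow> 'c::ab_group_add \<Rightarrow> 'c) \<Rightarrow> ('a \<Rightarrow> 'b \<Rightarrow> 'c) \<Rightarrow> bool" where
  "bilinear_map sA sB sC h \<longleftrightarrow>
     (\<forall>y. Vector_Spaces.linear sA sC (\<lambda>x. h x y)) \<and> (\<forall>x. Vector_Spaces.linear sB sC (h x))"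

locale nonunital_algebra = vector_space scaleA
  for scaleA :: "'k::field \<Rightarrow> 'a::ab_group_add \<Rightarrow> 'a" +
  fixes mult :: "'a \<Rightarrow> 'a \<Rightarrow> 'a"
  assumes bilinear_mult: "bilinear_map scaleA scaleA scaleA mult"
    and mult_assoc: "mult (mult x y) z = mult x (mult y z)"

locale nonunital_module =
  nonunital_algebra scaleA mult + V: vector_space scaleV
  for scaleA :: "'k::field \<Rightarrow> 'a::ab_group_add \<Rightarrow> 'a"
    and mult :: "'a \<Rightarrow> 'a \<Rightarrow> 'a"
    and scaleV :: "'k \<Rightarrow> 'v::ab_group_add \<Rightarrow> 'v" +
  fixes act :: "'a \<Rightarrow> 'v \<Rightarrow> 'v"
  assumes bilinear_act: "bilinear_map scaleA scaleV scaleV act"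
    and act_act: "act x (act y v) = act (mult x y) v"

context vector_space
begin

definition direct_sum_decomposition :: "'b set \<Rightarrow> 'b set \<Rightarrow> bool" where
  "direct_sum_decomposition U W \<longleftrightarrow>
     subspace U \<and> subspace W \<and> (\<forall>v. \<exists>u\<in>U. \<exists>w\<in>W. v = u + w) \<and> U \<inter> W = {0}"

text \<open>Linearity of a map between two subspaces; its values outside \<open>U\<close> are irrelevant.\<close>

definition linear_between :: "'b set \<Rightarrow> 'b set \<Rightarrow> ('b \<Rightarrow> 'b) \<Rightarrow> bool" where
  "linear_between U W h \<longleftrightarrow>
     (\<forall>u\<in>U. h u \<in> W) \<and>
     (\<forall>u\<in>U. \<forall>u'\<in>U. h (u + u') = h u + h u') \<and>
     (\<forall>c. \<forall>u\<in>U. h (scale c u) = scale c (h u))"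

end

text \<open>
  The space \<open>K\<^sup>N\<close> is \<open>'k ^ 'n\<close> with \<open>N = CARD('n)\<close>, so \<open>N \<ge> 1\<close> is automatic. The index type
  carries no numbering: a parameter \<open>o1 :: 'n\<close> plays the role of the index 1, and the indices
  \<open>i \<ge> 2\<close> are the \<open>i \<noteq> o1\<close>.
\<close>

abbreviation \<epsilon> :: "'n::finite \<Rightarrow> 'k::field ^ 'n" where
  "\<epsilon> i \<equiv> axis i 1"

text \<open>The bilinear extension of \<open>\<epsilon> i \<triangleleft> \<epsilon> j = \<delta>\<^bsub>1,j\<^esub> \<epsilon> i\<close>.\<close>

definition g_mult :: "'n::finite \<Rightarrow> 'k::field ^ 'n \<Rightarrow> 'k ^ 'n \<Rightarrow> 'k ^ 'n" where
  "g_mult o1 x y = (\<Sum>i\<in>UNIV. \<Sum>j\<in>UNIV. (x $ i * y $ j) *s (if j = o1 then \<epsilon> i else 0))"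

lemma g_mult_eq: "g_mult o1 x y = (y $ o1) *s x"
proof -
  have "g_mult o1 x y = (\<Sum>i\<in>UNIV. (x $ i * y $ o1) *s \<epsilon> i)"
    unfolding g_mult_def by (simp add: if_distrib cong: if_cong)
  also have "\<dots> = (y $ o1) *s x"
    by (simp add: vec_eq_iff axis_def if_distrib cong: if_cong)
  finally show ?thesis .
qed

lemma g_mult_basis: "g_mult o1 (\<epsilon> i) (\<epsilon> j) = (if j = o1 then \<epsilon> i else 0)"
  by (auto simp: g_mult_eq axis_def vec_eq_iff)

lemma nonunital_algebra_g:
  "nonunital_algebra ((*s) :: 'k::field \<Rightarrow> 'k ^ 'n::finite \<Rightarrow> 'k ^ 'n) (g_mult o1)"
proof unfold_locales
  show "bilinear_map (*s) (*s) (*s) (g_mult o1 :: 'k ^ 'n \<Rightarrow> _)"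
    unfolding bilinear_map_def g_mult_eq
    by (auto simp: Vector_Spaces.linear_iff vec.vector_space_axioms vec_eq_iff algebra_simps)
  show "g_mult o1 (g_mult o1 x y) z = g_mult o1 x (g_mult o1 y z)" for x y z :: "'k ^ 'n"
    by (simp add: g_mult_eq vec_eq_iff)
qed

definition prescribed_action ::
  "'n::finite \<Rightarrow> 'v::ab_group_add set \<Rightarrow> 'v set \<Rightarrow> ('n \<Rightarrow> 'v \<Rightarrow> 'v) \<Rightarrow>
   ('k::field ^ 'n \<Rightarrow> 'v \<Rightarrow> 'v) \<Rightarrow> bool" where
  "prescribed_action o1 V1 V0 f act \<longleftrightarrow>
     (\<forall>v\<in>V1. act (\<epsilon> o1) v = v) \<and> (\<forall>v\<in>V0. act (\<epsilon> o1) v = 0) \<and>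
     (\<forall>i. i \<noteq> o1 \<longrightarrow> (\<forall>v\<in>V1. act (\<epsilon> i) v = f i v) \<and> (\<forall>v\<in>V0. act (\<epsilon> i) v = 0))"

end

theory Submission
  imports Defs
begin

text \<open>
  Since \<open>x \<triangleleft> \<epsilon>\<^sub>1 = x\<close> for every \<open>x\<close>, the element \<open>\<epsilon>\<^sub>1\<close> acts on a module as an idempotent, whose
  kernel and image are \<open>V\<^sup>(\<^sup>0\<^sup>)\<close> and \<open>V\<^sup>(\<^sup>1\<^sup>)\<close>. The same identity gives \<open>x.v = x.(\<epsilon>\<^sub>1.v) = 0\<close> on the
  kernel, and \<open>\<epsilon>\<^sub>1 \<triangleleft> \<epsilon>\<^sub>i = 0\<close> puts the image of \<open>\<epsilon>\<^sub>i\<close> in the kernel for \<open>i \<ge> 2\<close>. Conversely, with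
  \<open>p\<close> the projection onto \<open>V\<^sup>(\<^sup>1\<^sup>)\<close> along \<open>V\<^sup>(\<^sup>0\<^sup>)\<close>, the action must be
  \<open>x.v = x\<^sub>1 p(v) + \<Sum>\<^sub>i x\<^sub>i f\<^sub>i(p(v))\<close>, summed over \<open>i \<ge> 2\<close>, and the \<open>p\<close>-component of \<open>y.v\<close> is \<open>y\<^sub>1 p(v)\<close>,
  so \<open>x.(y.v) = y\<^sub>1 (x.v) = (x \<triangleleft> y).v\<close>.
\<close>

lemma bilinear_map_add_left: "bilinear_map sA sB sC h \<Longrightarrow> h (x + x') y = h x y + h x' y"
  and bilinear_map_scale_left: "bilinear_map sA sB sC h \<Longrightarrow> h (sA c x) y = sC c (h x y)"
  and bilinear_map_add_right: "bilinear_map sA sB sC h \<Longrightarrow> h x (y + y') = h x y + h x y'"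
  and bilinear_map_scale_right: "bilinear_map sA sB sC h \<Longrightarrow> h x (sB c y) = sC c (h x y)"
  by (auto simp: bilinear_map_def Vector_Spaces.linear_iff)

lemma bilinear_map_zero_left: "bilinear_map sA sB sC h \<Longrightarrow> h 0 y = 0"
  using bilinear_map_add_left[of sA sB sC h 0 0 y] by simp

lemma bilinear_map_zero_right: "bilinear_map sA sB sC h \<Longrightarrow> h x 0 = 0"
  using bilinear_map_add_right[of sA sB sC h x 0 0] by simp

text \<open>Reduces questions about an action to the basis vectors; both the uniqueness of the
  action and its vanishing on \<open>V0\<close> are settled this way.\<close>

lemma bilinear_map_basis_expansion:
  fixes x :: "'k::field ^ 'n::finite"
  assumes "bilinear_map (*s) sB sC h"
  shows "h x y = (\<Sum>i\<in>UNIV. sC (x $ i) (h (\<epsilon> i) y))"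
proof -
  have "h (\<Sum>i\<in>A. x $ i *s \<epsilon> i) y = (\<Sum>i\<in>A. sC (x $ i) (h (\<epsilon> i) y))" if "finite A" for A
    using that
    by (induction A rule: finite_induct)
      (simp_all add: bilinear_map_zero_left[OF assms] bilinear_map_add_left[OF assms]
        bilinear_map_scale_left[OF assms])
  from this[of UNIV] show ?thesis
    by (simp add: basis_expansion)
qed

lemma g_mult_o1_right: "g_mult o1 x (\<epsilon> o1) = x"
  by (simp add: g_mult_eq)

context vector_space
begin

text \<open>In this locale \<open>*s\<close> would also denote \<open>scale\<close>; from here on it
  is kept for the scalar multiplication of \<open>'a ^ 'n\<close>.\<close>

no_notation scale (infixr \<open>*s\<close> 75)

text \<open>One linear operator per basis vector can be chosen freely; the existence of the action
  rests on this.\<close>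

lemma bilinear_map_of_basis_action:
  fixes g :: "'n::finite \<Rightarrow> 'b \<Rightarrow> 'b"
  assumes g: "\<And>i. Vector_Spaces.linear scale scale (g i)"
  shows "bilinear_map (*s) scale scale (\<lambda>x v. \<Sum>i\<in>UNIV. scale (x $ i) (g i v))"
proof -
  have add: "g i (u + v) = g i u + g i v" and scl: "g i (scale c v) = scale c (g i v)" for i u v c
    using g[of i] by (simp_all add: Vector_Spaces.linear_iff)
  show ?thesis
    unfolding bilinear_map_def Vector_Spaces.linear_iff
    by (auto simp: vector_space_axioms vec.vector_space_axioms add scl scale_left_distrib
        scale_right_distrib sum.distrib scale_sum_right mult.commute)
qed

lemma direct_sum_decomposition_unique:
  assumes "direct_sum_decomposition U W"
    and "u \<in> U" "w \<in> W" "u' \<in> U" "w' \<in> W" "u + w = u' + w'"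
  shows "u = u'"
proof -
  have "u - u' = w' - w"
    using assms(6) by (simp add: algebra_simps)
  then have "u - u' \<in> U \<inter> W"
    using assms unfolding direct_sum_decomposition_def by (metis IntI subspace_diff)
  then show ?thesis
    using assms(1) unfolding direct_sum_decomposition_def by auto
qed

lemma direct_sum_projection:
  assumes dec: "direct_sum_decomposition U W"
  obtains p where "Vector_Spaces.linear scale scale p" "\<And>v. p v \<in> U" "\<And>v. v - p v \<in> W"
    "\<And>u. u \<in> U \<Longrightarrow> p u = u" "\<And>w. w \<in> W \<Longrightarrow> p w = 0"
proof -
  have U: "subspace U" and W: "subspace W"
    using dec by (auto simp: direct_sum_decomposition_def)
  have "\<exists>u. u \<in> U \<and> v - u \<in> W" for v
    using dec unfolding direct_sum_decomposition_def by (metis add_diff_cancel_left')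
  then obtain p where pU: "\<And>v. p v \<in> U" and pW: "\<And>v. v - p v \<in> W"
    by metis
  \<comment> \<open>\<open>p\<close> was only chosen pointwise. This characterization of its value
    reduces linearity and the values on \<open>U\<close> and \<open>W\<close> to exhibiting a
    suitable candidate \<open>u\<close>.\<close>
  have p_eq: "p v = u" if "u \<in> U" "v - u \<in> W" for u v
    using direct_sum_decomposition_unique[OF dec pU[of v] pW[of v] that] by simp
  have "p (u + v) = p u + p v" for u v
    using subspace_add[OF U pU pU, of u v] subspace_add[OF W pW pW, of u v]
    by (intro p_eq) (simp_all add: algebra_simps)
  moreover have "p (scale c v) = scale c (p v)" for c v
    using subspace_scale[OF U pU, of c v] subspace_scale[OF W pW, of c v]
    by (intro p_eq) (simp_all add: scale_right_diff_distrib)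
  ultimately have "Vector_Spaces.linear scale scale p"
    by (simp add: Vector_Spaces.linear_iff vector_space_axioms)
  moreover have "p u = u" if "u \<in> U" for u
    using that subspace_0[OF W] by (intro p_eq) simp_all
  moreover have "p w = 0" if "w \<in> W" for w
    using that subspace_0[OF U] by (intro p_eq) simp_all
  ultimately show ?thesis
    using pU pW that by blast
qed

text \<open>A map given only on \<open>U\<close> becomes linear on the whole space once precomposed
  with a projection onto \<open>U\<close>.\<close>

lemma linear_between_compose:
  assumes "Vector_Spaces.linear scale scale p" "\<And>v. p v \<in> U" "linear_between U W h"
  shows "Vector_Spaces.linear scale scale (\<lambda>v. h (p v))"
  using assms by (auto simp: Vector_Spaces.linear_iff linear_between_def)

lemma nonunital_module_decomposition:
  fixes o1 :: "'n::finite" and act :: "'a ^ 'n \<Rightarrow> 'b \<Rightarrow> 'b"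
  assumes "nonunital_module (*s) (g_mult o1) scale act"
  shows "\<exists>V0 V1. direct_sum_decomposition V0 V1 \<and>
    (\<forall>v\<in>V1. act (\<epsilon> o1) v = v) \<and> (\<forall>v\<in>V0. act (\<epsilon> o1) v = 0) \<and>
    (\<forall>i. i \<noteq> o1 \<longrightarrow> (\<forall>v\<in>V1. act (\<epsilon> i) v \<in> V0) \<and> (\<forall>v\<in>V0. act (\<epsilon> i) v = 0))"
proof -
  have bil: "bilinear_map (*s) scale scale act"
    and act_act: "\<And>x y v. act x (act y v) = act (g_mult o1 x y) v"
    using assms by (auto simp: nonunital_module_def nonunital_module_axioms_def)
  let ?e = "act (\<epsilon> o1)"
  define V0 where "V0 = {v. ?e v = 0}"
  define V1 where "V1 = {v. ?e v = v}"
  note act_simps = bilinear_map_add_right[OF bil] bilinear_map_scale_right[OF bil]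
    bilinear_map_zero_right[OF bil]
  have act_e: "act x (?e v) = act x v" for x v
    by (simp add: act_act g_mult_o1_right)
  have "subspace V0" "subspace V1"
    by (auto simp: V0_def V1_def subspace_def act_simps)
  moreover have "\<exists>u\<in>V0. \<exists>w\<in>V1. v = u + w" for v
  proof (intro bexI)
    show "?e v \<in> V1"
      by (simp add: V1_def act_e)
    \<comment> \<open>The left side is \<open>?e v\<close>, and by idempotence so is the last
      summand, so \<open>?e (v - ?e v)\<close> must be zero.\<close>
    have "?e ((v - ?e v) + ?e v) = ?e (v - ?e v) + ?e (?e v)"
      by (rule bilinear_map_add_right[OF bil])
    then show "v - ?e v \<in> V0"
      by (simp add: V0_def act_e)
  qed simp
  moreover have "V0 \<inter> V1 = {0}"
    by (auto simp: V0_def V1_def act_simps)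
  ultimately have "direct_sum_decomposition V0 V1"
    unfolding direct_sum_decomposition_def by blast
  moreover have "act (\<epsilon> i) v \<in> V0" if "i \<noteq> o1" for i v
    using that by (simp add: V0_def act_act g_mult_basis bilinear_map_zero_left[OF bil])
  moreover have "act x v = 0" if "v \<in> V0" for x v
    using act_e[of x v] that by (simp add: V0_def act_simps)
  moreover have "\<forall>v\<in>V1. ?e v = v"
    by (simp add: V1_def)
  ultimately show ?thesis
    by blast
qed

context
  fixes o1 :: "'n::finite" and V1 V0 :: "'b set" and f :: "'n \<Rightarrow> 'b \<Rightarrow> 'b"
  assumes dec: "direct_sum_decomposition V1 V0"
    and f: "\<And>i. i \<noteq> o1 \<Longrightarrow> linear_between V1 V0 (f i)"
begin

lemma prescribed_action_exists:
  "\<exists>act :: 'a ^ 'n \<Rightarrow> 'b \<Rightarrow> 'b.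
    bilinear_map (*s) scale scale act \<and> prescribed_action o1 V1 V0 f act"
proof -
  obtain p where p: "Vector_Spaces.linear scale scale p" "\<And>v. p v \<in> V1"
    and p1: "\<And>v. v \<in> V1 \<Longrightarrow> p v = v" and p0: "\<And>v. v \<in> V0 \<Longrightarrow> p v = 0"
    using direct_sum_projection[OF dec] by metis
  define g where "g i = (if i = o1 then p else (\<lambda>v. f i (p v)))" for i
  have lin: "Vector_Spaces.linear scale scale (g i)" for i
    using p(1) linear_between_compose[OF p f[of i]] by (cases "i = o1") (simp_all add: g_def)
  define act :: "'a ^ 'n \<Rightarrow> 'b \<Rightarrow> 'b" where "act x v = (\<Sum>i\<in>UNIV. scale (x $ i) (g i v))" for x v
  have "act (\<epsilon> i) v = g i v" for i v
    by (simp add: act_def axis_def if_distrib[of "\<lambda>c. scale c _"] cong: if_cong)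
  moreover have "g i v = 0" if "v \<in> V0" for i v
  proof -
    have "p 0 = 0"
      using p0 dec by (simp add: direct_sum_decomposition_def subspace_0)
    \<comment> \<open>The definition of \<open>linear_between\<close> does not list
      \<open>f i 0 = 0\<close>, so the vanishing at 0 is drawn from the additivity of
      \<open>g i\<close>.\<close>
    then have "g i v = g i 0"
      using p0[OF that] by (simp add: g_def)
    moreover have "g i (0 + 0) = g i 0 + g i 0"
      using lin[of i] unfolding Vector_Spaces.linear_iff by blast
    ultimately show ?thesis
      by simp
  qed
  moreover have "g o1 v = v" "i \<noteq> o1 \<Longrightarrow> g i v = f i v" if "v \<in> V1" for i v
    using p1[OF that] by (simp_all add: g_def)
  ultimately have "prescribed_action o1 V1 V0 f act"
    unfolding prescribed_action_def by simp
  moreover have "bilinear_map (*s) scale scale act"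
    unfolding act_def by (rule bilinear_map_of_basis_action[OF lin])
  ultimately show ?thesis
    by blast
qed

text \<open>By bilinearity an action is fixed by what the basis vectors do on the two summands, and
  \<open>prescribed_action\<close> lists exactly these values.\<close>

lemma prescribed_action_unique:
  fixes act act' :: "'a ^ 'n \<Rightarrow> 'b \<Rightarrow> 'b"
  assumes bil: "bilinear_map (*s) scale scale act" "bilinear_map (*s) scale scale act'"
    and pre: "prescribed_action o1 V1 V0 f act" "prescribed_action o1 V1 V0 f act'"
  shows "act = act'"
proof (intro ext)
  fix x v
  obtain u w where v: "u \<in> V1" "w \<in> V0" "v = u + w"
    using dec unfolding direct_sum_decomposition_def by blast
  have "act (\<epsilon> i) v = act' (\<epsilon> i) v" for i
    using v pre unfolding prescribed_action_def
    by (cases "i = o1") (simp_all add: bilinear_map_add_right[OF bil(1)] bilinear_map_add_right[OF bil(2)])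
  then show "act x v = act' x v"
    by (simp add: bilinear_map_basis_expansion[OF bil(1), of x] bilinear_map_basis_expansion[OF bil(2), of x])
qed

text \<open>The argument works from the prescribed values alone and so applies to any such
  \<open>act\<close>, without the explicit formula behind existence.\<close>

lemma prescribed_action_module:
  fixes act :: "'a ^ 'n \<Rightarrow> 'b \<Rightarrow> 'b"
  assumes bil: "bilinear_map (*s) scale scale act"
    and pre: "prescribed_action o1 V1 V0 f act"
  shows "nonunital_module (*s) (g_mult o1) scale act"
proof -
  have V0: "subspace V0"
    using dec by (simp add: direct_sum_decomposition_def)
  have act_V0: "act x w = 0" if "w \<in> V0" for x w
  proof -
    have "act (\<epsilon> i) w = 0" for i
      using pre that unfolding prescribed_action_def by (cases "i = o1") auto
    then show ?thesis
      by (simp add: bilinear_map_basis_expansion[OF bil, of x])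
  qed
  \<comment> \<open>Modulo \<open>V0\<close>, \<open>y\<close> acts on \<open>V1\<close> as the
    scalar \<open>y $ o1\<close>, because every \<open>f i\<close> with \<open>i \<noteq> o1\<close>
    takes its values in \<open>V0\<close>.\<close>
  have act_V1: "act y u - scale (y $ o1) u \<in> V0" if u: "u \<in> V1" for y u
  proof -
    have "act y u = scale (y $ o1) u + (\<Sum>i\<in>UNIV - {o1}. scale (y $ i) (act (\<epsilon> i) u))"
      using pre u unfolding prescribed_action_def
      by (simp add: bilinear_map_basis_expansion[OF bil, of y] sum.remove[of UNIV o1])
    moreover have "(\<Sum>i\<in>UNIV - {o1}. scale (y $ i) (act (\<epsilon> i) u)) \<in> V0"
      using pre u f unfolding prescribed_action_def linear_between_def
      by (intro subspace_sum[OF V0] subspace_scale[OF V0]) auto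
    ultimately show ?thesis
      by simp
  qed
  have act_act: "act x (act y v) = act (g_mult o1 x y) v" for x y v
  proof -
    obtain u w where v: "u \<in> V1" "w \<in> V0" "v = u + w"
      using dec unfolding direct_sum_decomposition_def by blast
    have act_v: "act z v = act z u" for z
      by (simp add: v(3) bilinear_map_add_right[OF bil] act_V0[OF v(2)])
    \<comment> \<open>The scalar part of \<open>act y u\<close> is split off; the remainder lies in
      \<open>V0\<close>, where \<open>x\<close> acts by zero.\<close>
    have "act x (act y u) = act x (scale (y $ o1) u + (act y u - scale (y $ o1) u))"
      by simp
    also have "\<dots> = scale (y $ o1) (act x u)"
      by (simp only: bilinear_map_add_right[OF bil] bilinear_map_scale_right[OF bil]
          act_V0[OF act_V1[OF v(1)]] add_0_right)
    finally show ?thesis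
      by (simp add: act_v g_mult_eq bilinear_map_scale_left[OF bil])
  qed
  show ?thesis
    by (intro nonunital_module.intro nonunital_algebra_g vector_space_axioms
        nonunital_module_axioms.intro bil act_act)
qed

end

end

theorem proposition8:
  fixes o1 :: "'n::finite"
    and scale :: "'k::field \<Rightarrow> 'v::ab_group_add \<Rightarrow> 'v"
  assumes "vector_space scale"
  shows
    "(\<forall>act. nonunital_module (*s) (g_mult o1 :: 'k ^ 'n \<Rightarrow> _) scale act \<longrightarrow>
       (\<exists>V0 V1. vector_space.direct_sum_decomposition scale V0 V1 \<and>
          (\<forall>v\<in>V1. act (\<epsilon> o1) v = v) \<and> (\<forall>v\<in>V0. act (\<epsilon> o1) v = 0) \<and>
          (\<forall>i. i \<noteq> o1 \<longrightarrow> (\<forall>v\<in>V1. act (\<epsilon> i) v \<in> V0) \<and> (\<forall>v\<in>V0. act (\<epsilon> i) v = 0))))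
     \<and>
     (\<forall>V1 V0 f. vector_space.direct_sum_decomposition scale V1 V0 \<longrightarrow>
       (\<forall>i. i \<noteq> o1 \<longrightarrow> vector_space.linear_between scale V1 V0 (f i)) \<longrightarrow>
       (\<exists>!act :: 'k ^ 'n \<Rightarrow> 'v \<Rightarrow> 'v.
          bilinear_map (*s) scale scale act \<and> prescribed_action o1 V1 V0 f act) \<and>
       (\<forall>act :: 'k ^ 'n \<Rightarrow> 'v \<Rightarrow> 'v.
          bilinear_map (*s) scale scale act \<and> prescribed_action o1 V1 V0 f act \<longrightarrow>
          nonunital_module (*s) (g_mult o1) scale act))"
proof -
  interpret vector_space scale
    by fact
  show ?thesis
  proof (intro conjI allI impI)
    fix V1 V0 and f :: "'n \<Rightarrow> 'v \<Rightarrow> 'v"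
    assume dec: "direct_sum_decomposition V1 V0"
      and "\<forall>i. i \<noteq> o1 \<longrightarrow> linear_between V1 V0 (f i)"
    then have f: "\<And>i. i \<noteq> o1 \<Longrightarrow> linear_between V1 V0 (f i)"
      by blast
    show "\<exists>!act :: 'k ^ 'n \<Rightarrow> 'v \<Rightarrow> 'v.
        bilinear_map (*s) scale scale act \<and> prescribed_action o1 V1 V0 f act"
      using prescribed_action_exists[of V1 V0 o1 f, OF dec f]
        prescribed_action_unique[of V1 V0 o1 f, OF dec f]
      by (intro ex_ex1I) blast+
    show "nonunital_module (*s) (g_mult o1) scale act"
      if "bilinear_map (*s) scale scale act \<and> prescribed_action o1 V1 V0 f act"
      for act :: "'k ^ 'n \<Rightarrow> 'v \<Rightarrow> 'v"
      using that prescribed_action_module[of V1 V0 o1 f, OF dec f] by blast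
  qed (rule nonunital_module_decomposition)
qed

end
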